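(* Let $c>1$ be a constant, let $s=s(n)\ge1$ be an integer, and let $G$ be a random graph from $G(n,p)$ with $p=\frac{c\log n}{n}$. Give each edge of $G$ a color from $[s]$ independently and uniformly at random. If $$s\le \frac{\log n}{\log c-1+\log\log n}-\frac12+\frac{\log\log\log n}{3\log\log n},$$ then asymptotically almost surely $G$ is not rainbow connected.
   Context: $\log$ is the natural logarithm. A path in the edge-colored graph $G$ is rainbow if its edges have pairwise distinct colors; $G$ is rainbow connected if every pair of distinct vertices is joined by a rainbow path. "Asymptotically almost surely" means with probability tending to $1$ as $n\to\infty$. *)

theory Defs
  imports "HOL-Probability.Probability" "HOL-Probability.Product_PMF"
begin

definition all_edges :: "nat \<Rightarrow> nat set set" where
  "all_edges n = {e. e \<subseteq> {..<n} \<and> card e = 2}"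

text \<open>The random graph \<open>G(n,p)\<close>, given by its edge set; the vertex set is \<open>{..<n}\<close>.
  As \<open>bernoulli_pmf\<close> truncates its parameter to \<open>[0,1]\<close>, this is the usual \<open>G(n,p)\<close>
  only for \<open>0 \<le> p \<le> 1\<close>; for \<open>p = c * ln n / n\<close> this holds for all large \<open>n\<close>.\<close>
definition gnp_pmf :: "nat \<Rightarrow> real \<Rightarrow> nat set set pmf" where
  "gnp_pmf n p =
     map_pmf (\<lambda>f. {e \<in> all_edges n. f e})
       (Pi_pmf (all_edges n) False (\<lambda>_. bernoulli_pmf p))"

text \<open>The value \<open>0\<close>, which is not a color, is the default of a coloring outside the edge set.\<close>
definition coloring_pmf :: "nat set set \<Rightarrow> nat \<Rightarrow> (nat set \<Rightarrow> nat) pmf" where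
  "coloring_pmf E s = Pi_pmf E 0 (\<lambda>_. pmf_of_set {1..s})"

definition colored_gnp_pmf ::
    "nat \<Rightarrow> real \<Rightarrow> nat \<Rightarrow> (nat set set \<times> (nat set \<Rightarrow> nat)) pmf" where
  "colored_gnp_pmf n p s =
     do { E \<leftarrow> gnp_pmf n p; col \<leftarrow> coloring_pmf E s; return_pmf (E, col) }"

fun path_edges :: "'a list \<Rightarrow> 'a set list" where
  "path_edges [] = []"
| "path_edges [x] = []"
| "path_edges (x # y # xs) = {x, y} # path_edges (y # xs)"

definition is_path :: "'a set \<Rightarrow> 'a set set \<Rightarrow> 'a list \<Rightarrow> bool" where
  "is_path V E xs \<longleftrightarrow>
     xs \<noteq> [] \<and> distinct xs \<and> set xs \<subseteq> V \<and> set (path_edges xs) \<subseteq> E"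

definition rainbow :: "('a set \<Rightarrow> 'c) \<Rightarrow> 'a list \<Rightarrow> bool" where
  "rainbow col xs \<longleftrightarrow> distinct (map col (path_edges xs))"

definition rainbow_connected :: "'a set \<Rightarrow> 'a set set \<Rightarrow> ('a set \<Rightarrow> 'c) \<Rightarrow> bool" where
  "rainbow_connected V E col \<longleftrightarrow>
     (\<forall>u\<in>V. \<forall>v\<in>V. u \<noteq> v \<longrightarrow>
        (\<exists>xs. is_path V E xs \<and> hd xs = u \<and> last xs = v \<and> rainbow col xs))"

end

theory Submission
  imports Defs "HOL-Real_Asymp.Real_Asymp"
begin

text \<open>
  The expected number of rainbow paths between two fixed vertices tends to \<open>0\<close>. With \<open>d = n p\<close>, there
  are at most \<open>n ^ (l - 1)\<close> candidates with \<open>l\<close> edges, each present with probability \<open>p ^ l\<close> and then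
  rainbow with probability \<open>s! / ((s - l)! s ^ l)\<close>. Summing over \<open>l\<close> and reversing the order of
  summation produces a partial sum of \<open>exp (s / d)\<close>, so the expectation is at most
  \<open>s! (d / s) ^ s exp (s / d) / n\<close>, which by Stirling is \<open>O(sqrt s * (d / e) ^ s exp (s / d) / n)\<close>.
  This bound increases with \<open>s\<close>, and for the largest \<open>s\<close> allowed its logarithm is about
  \<open>- ln (ln (ln n)) / 6\<close>.
\<close>

lemma length_path_edges: "length (path_edges xs) = length xs - 1"
  by (induction xs rule: path_edges.induct) auto

lemma path_edges_subset_Pow: "set (path_edges xs) \<subseteq> Pow (set xs)"
  by (induction xs rule: path_edges.induct) auto

lemma distinct_path_edges: "distinct xs \<Longrightarrow> distinct (path_edges xs)"
proof (induction xs rule: path_edges.induct)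
  case (3 x y xs)
  have "{x, y} \<notin> set (path_edges (y # xs))"
    using path_edges_subset_Pow[of "y # xs"] "3.prems" by auto
  then show ?case using 3 by simp
qed auto

lemma card_path_edge: "distinct xs \<Longrightarrow> e \<in> set (path_edges xs) \<Longrightarrow> card e = 2"
  by (induction xs rule: path_edges.induct) auto

lemma path_edges_subset_all_edges:
  assumes "distinct xs" "set xs \<subseteq> {..<n}"
  shows "set (path_edges xs) \<subseteq> all_edges n"
  using assms path_edges_subset_Pow card_path_edge unfolding all_edges_def by fastforce

definition simple_paths :: "'a set \<Rightarrow> 'a \<Rightarrow> 'a \<Rightarrow> nat \<Rightarrow> 'a list set" where
  "simple_paths V u v l =
     {xs. length xs = Suc l \<and> distinct xs \<and> set xs \<subseteq> V \<and> hd xs = u \<and> last xs = v}"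

lemma finite_simple_paths: "finite V \<Longrightarrow> finite (simple_paths V u v l)"
  unfolding simple_paths_def by (rule finite_subset[OF _ finite_subset_distinct]) auto

lemma card_simple_paths_le:
  assumes "finite V" "u \<noteq> v"
  shows "card V * card (simple_paths V u v l) \<le> card V ^ l"
proof (cases l)
  case 0
  have "simple_paths V u v 0 = {}"
    using assms(2) by (auto simp: simple_paths_def length_Suc_conv)
  then show ?thesis using 0 by simp
next
  case (Suc k)
  let ?inner = "{ys. set ys \<subseteq> V \<and> length ys = k}"
  have "simple_paths V u v l \<subseteq> (\<lambda>ys. u # ys @ [v]) ` ?inner"
  proof
    fix xs assume "xs \<in> simple_paths V u v l"
    moreover from this obtain x ys y where "xs = x # ys @ [y]"
      by (cases xs; cases "tl xs" rule: rev_cases) (auto simp: simple_paths_def Suc)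
    ultimately show "xs \<in> (\<lambda>ys. u # ys @ [v]) ` ?inner"
      by (auto simp: simple_paths_def Suc)
  qed
  then have "card (simple_paths V u v l) \<le> card ?inner"
    using assms(1) by (intro surj_card_le finite_lists_length_eq)
  then show ?thesis using assms(1) by (simp add: Suc card_lists_length_eq)
qed

definition rainbow_joined :: "'a set \<Rightarrow> 'a set set \<Rightarrow> ('a set \<Rightarrow> 'c) \<Rightarrow> 'a \<Rightarrow> 'a \<Rightarrow> bool" where
  "rainbow_joined V E col u v \<longleftrightarrow>
     (\<exists>xs. is_path V E xs \<and> hd xs = u \<and> last xs = v \<and> rainbow col xs)"

lemma rainbow_connected_imp_joined:
  "rainbow_connected V E col \<Longrightarrow> u \<in> V \<Longrightarrow> v \<in> V \<Longrightarrow> u \<noteq> v \<Longrightarrow> rainbow_joined V E col u v"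
  by (simp add: rainbow_connected_def rainbow_joined_def)

lemma rainbow_joined_imp_simple_path:
  assumes "rainbow_joined V E col u v" "finite V"
  shows "\<exists>l<card V. \<exists>xs\<in>simple_paths V u v l.
    set (path_edges xs) \<subseteq> E \<and> distinct (map col (path_edges xs))"
proof -
  obtain xs where path: "is_path V E xs" and ends: "hd xs = u" "last xs = v"
    and rainbow: "rainbow col xs"
    using assms(1) by (auto simp: rainbow_joined_def)
  then obtain l where length: "length xs = Suc l"
    by (cases xs) (auto simp: is_path_def)
  have "length xs \<le> card V"
    using path assms(2) card_mono[of V "set xs"] by (simp add: is_path_def distinct_card)
  then have "l < card V"
    by (simp add: length)
  moreover have "xs \<in> simple_paths V u v l"
    using path ends length by (simp add: is_path_def simple_paths_def)
  ultimately show ?thesis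
    using path rainbow by (auto simp: is_path_def rainbow_def)
qed

lemma card_distinct_lists:
  assumes "finite A"
  shows "card {xs. length xs = l \<and> distinct xs \<and> set xs \<subseteq> A} = (card A choose l) * fact l"
proof -
  let ?S = "{S. S \<subseteq> A \<and> card S = l}"
  have fin: "finite S" if "S \<in> ?S" for S
    using that assms finite_subset by blast
  have "{xs. length xs = l \<and> distinct xs \<and> set xs \<subseteq> A} = (\<Union>S\<in>?S. permutations_of_set S)"
    by (auto simp: permutations_of_set_def distinct_card)
  also have "card \<dots> = (\<Sum>S\<in>?S. card (permutations_of_set S))"
    using assms by (intro card_UN_disjoint) (auto dest: permutations_of_setD)
  also have "\<dots> = (\<Sum>S\<in>?S. fact l)"
    using fin by (intro sum.cong) auto
  finally show ?thesis
    using assms by (simp add: n_subsets)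
qed

lemma map_Pi_pmf_of_set:
  assumes A: "finite A" "distinct xs" "set xs \<subseteq> A" and B: "finite B" "B \<noteq> {}"
  shows "map_pmf (\<lambda>f. map f xs) (Pi_pmf A d (\<lambda>_. pmf_of_set B)) =
    pmf_of_set {ys. set ys \<subseteq> B \<and> length ys = length xs}"
proof -
  let ?D = "PiE_dflt (set xs) d (\<lambda>_. B)" and ?L = "{ys. set ys \<subseteq> B \<and> length ys = length xs}"
  have inj: "inj_on (\<lambda>f. map f xs) ?D"
  proof (intro inj_onI ext)
    fix f g x assume "f \<in> ?D" "g \<in> ?D" "map f xs = map g xs"
    then show "f x = g x"
      by (cases "x \<in> set xs") (auto simp: PiE_dflt_def)
  qed
  have "card ?D = card ?L"
    using A(2) B(1) by (simp add: card_PiE_dflt card_lists_length_eq distinct_card)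
  then have image: "(\<lambda>f. map f xs) ` ?D = ?L"
    using B(1) inj by (intro card_subset_eq finite_lists_length_eq) (auto simp: PiE_dflt_def card_image)
  have "map_pmf (\<lambda>f. map f xs) (Pi_pmf A d (\<lambda>_. pmf_of_set B)) =
      map_pmf (\<lambda>f. map f xs) (Pi_pmf (set xs) d (\<lambda>_. pmf_of_set B))"
    by (subst Pi_pmf_subset[OF A(1,3)]) (simp add: map_pmf_comp cong: map_cong)
  also have "\<dots> = map_pmf (\<lambda>f. map f xs) (pmf_of_set ?D)"
    using B by (subst Pi_pmf_of_set) auto
  also have "\<dots> = pmf_of_set ?L"
    unfolding image[symmetric] using B
    by (intro map_pmf_of_set_inj inj finite_PiE_dflt) auto
  finally show ?thesis .
qed

definition distinct_prob :: "nat \<Rightarrow> nat \<Rightarrow> real" where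
  "distinct_prob s l = real ((s choose l) * fact l) / real s ^ l"

lemma distinct_prob_nonneg: "distinct_prob s l \<ge> 0"
  by (simp add: distinct_prob_def)

lemma distinct_prob_eq_0: "l > s \<Longrightarrow> distinct_prob s l = 0"
  by (simp add: distinct_prob_def binomial_eq_0)

lemma prob_distinct_map_Pi_pmf_of_set:
  assumes A: "finite A" "distinct xs" "set xs \<subseteq> A" and B: "finite B" "B \<noteq> {}"
  shows "measure_pmf.prob (Pi_pmf A d (\<lambda>_. pmf_of_set B)) {f. distinct (map f xs)} =
    distinct_prob (card B) (length xs)"
proof -
  let ?L = "{ys. set ys \<subseteq> B \<and> length ys = length xs}"
  have "card ?L = card B ^ length xs" "finite ?L"
    using B(1) by (simp_all add: card_lists_length_eq finite_lists_length_eq)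
  moreover from this have "?L \<noteq> {}"
    using B by (metis card_eq_0_iff power_not_zero)
  moreover have "?L \<inter> {ys. distinct ys} = {ys. length ys = length xs \<and> distinct ys \<and> set ys \<subseteq> B}"
    by auto
  ultimately have "measure_pmf.prob (pmf_of_set ?L) {ys. distinct ys} =
      distinct_prob (card B) (length xs)"
    using B(1) by (simp add: measure_pmf_of_set card_distinct_lists distinct_prob_def)
  then show ?thesis
    unfolding map_Pi_pmf_of_set[OF assms, symmetric, of d] by simp
qed

lemma finite_all_edges: "finite (all_edges n)"
  unfolding all_edges_def by (rule finite_subset[of _ "Pow {..<n}"]) auto

lemma set_gnp_pmf_subset: "E \<in> set_pmf (gnp_pmf n p) \<Longrightarrow> E \<subseteq> all_edges n"
  by (auto simp: gnp_pmf_def)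

lemma prob_gnp_superset:
  assumes "F \<subseteq> all_edges n" "0 \<le> p" "p \<le> 1"
  shows "measure_pmf.prob (gnp_pmf n p) {E. F \<subseteq> E} = p ^ card F"
proof -
  let ?P = "Pi_pmf (all_edges n) False (\<lambda>_. bernoulli_pmf p)"
  let ?B = "\<lambda>e. if e \<in> F then {True} else UNIV"
  have "measure_pmf.prob (gnp_pmf n p) {E. F \<subseteq> E} = measure_pmf.prob ?P (Pi (all_edges n) ?B)"
    unfolding gnp_pmf_def using assms(1)
    by (auto intro!: arg_cong[where f = "measure_pmf.prob _"] simp: Pi_def split: if_splits)
  also have "\<dots> = (\<Prod>e\<in>all_edges n. measure_pmf.prob (bernoulli_pmf p) (?B e))"
    by (rule measure_Pi_pmf_Pi[OF finite_all_edges])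
  also have "\<dots> = (\<Prod>e\<in>all_edges n. if e \<in> F then p else 1)"
    using assms by (intro prod.cong) (auto simp: measure_pmf_single)
  also have "\<dots> = p ^ card F"
    using assms(1) by (simp add: prod.If_cases finite_all_edges Int_absorb1)
  finally show ?thesis .
qed

lemma prob_bind_pmf:
  "measure_pmf.prob (bind_pmf M f) A = measure_pmf.expectation M (\<lambda>x. measure_pmf.prob (f x) A)"
  unfolding measure_pmf_bind
  by (subst measure_pmf.measure_bind[where N = "count_space UNIV"])
     (auto simp: measure_pmf_in_subprob_algebra)

lemma prob_rainbow_edges:
  assumes es: "distinct es" "set es \<subseteq> all_edges n" and p: "0 \<le> p" "p \<le> 1" and s: "s \<ge> 1"
  shows "measure_pmf.prob (colored_gnp_pmf n p s) {(E, col). set es \<subseteq> E \<and> distinct (map col es)} =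
    p ^ length es * distinct_prob s (length es)"
proof -
  let ?A = "{(E, col). set es \<subseteq> E \<and> distinct (map col es)}"
  let ?q = "distinct_prob s (length es)"
  have given_E: "measure_pmf.prob (map_pmf (Pair E) (coloring_pmf E s)) ?A =
      indicator {E. set es \<subseteq> E} E * ?q" if "E \<in> set_pmf (gnp_pmf n p)" for E
  proof -
    have "finite E"
      using set_gnp_pmf_subset[OF that] finite_all_edges by (rule finite_subset)
    then have "measure_pmf.prob (coloring_pmf E s) {col. distinct (map col es)} = ?q"
      if "set es \<subseteq> E"
      using prob_distinct_map_Pi_pmf_of_set[OF _ es(1) that, of "{1..s}" 0] s
      by (simp add: coloring_pmf_def)
    moreover have "Pair E -` ?A = (if set es \<subseteq> E then {col. distinct (map col es)} else {})"
      by auto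
    ultimately show ?thesis
      by simp
  qed
  have "measure_pmf.prob (colored_gnp_pmf n p s) ?A =
      measure_pmf.expectation (gnp_pmf n p)
        (\<lambda>E. measure_pmf.prob (map_pmf (Pair E) (coloring_pmf E s)) ?A)"
    unfolding colored_gnp_pmf_def map_pmf_def[symmetric] by (rule prob_bind_pmf)
  also have "\<dots> = measure_pmf.expectation (gnp_pmf n p) (\<lambda>E. indicator {E. set es \<subseteq> E} E * ?q)"
    using given_E by (intro integral_cong_AE) (auto simp: AE_measure_pmf_iff)
  also have "\<dots> = measure_pmf.prob (gnp_pmf n p) {E. set es \<subseteq> E} * ?q"
    by simp
  finally show ?thesis
    using es p by (simp add: prob_gnp_superset distinct_card)
qed

lemma prob_rainbow_joined_le_sum_paths:
  assumes p: "0 \<le> p" "p \<le> 1" and s: "s \<ge> 1"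
  shows "measure_pmf.prob (colored_gnp_pmf n p s) {(E, col). rainbow_joined {..<n} E col u v}
    \<le> (\<Sum>l<n. real (card (simple_paths {..<n} u v l)) * (p ^ l * distinct_prob s l))"
proof -
  let ?P = "measure_pmf.prob (colored_gnp_pmf n p s)"
  let ?S = "simple_paths {..<n} u v"
  let ?A = "\<lambda>xs. {(E, col :: nat set \<Rightarrow> nat).
      set (path_edges xs) \<subseteq> E \<and> distinct (map col (path_edges xs))}"
  have prob_path: "?P (?A xs) = p ^ l * distinct_prob s l" if "xs \<in> ?S l" for l xs
    using that prob_rainbow_edges[OF distinct_path_edges path_edges_subset_all_edges p s, of xs n]
    by (simp add: length_path_edges simple_paths_def)
  have "?P {(E, col). rainbow_joined {..<n} E col u v} \<le> ?P (\<Union>l<n. \<Union>xs\<in>?S l. ?A xs)"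
    by (intro measure_pmf.finite_measure_mono) (auto dest!: rainbow_joined_imp_simple_path)
  also have "\<dots> \<le> (\<Sum>l<n. ?P (\<Union>xs\<in>?S l. ?A xs))"
    by (intro measure_pmf.finite_measure_subadditive_finite) auto
  also have "\<dots> \<le> (\<Sum>l<n. \<Sum>xs\<in>?S l. ?P (?A xs))"
    by (intro sum_mono measure_pmf.finite_measure_subadditive_finite finite_simple_paths) auto
  also have "\<dots> = (\<Sum>l<n. real (card (?S l)) * (p ^ l * distinct_prob s l))"
    using prob_path by simp
  finally show ?thesis .
qed

lemma prob_rainbow_joined_le:
  assumes "u \<noteq> v" and p: "0 \<le> p" "p \<le> 1" and s: "s \<ge> 1"
  shows "real n *
      measure_pmf.prob (colored_gnp_pmf n p s) {(E, col). rainbow_joined {..<n} E col u v}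
    \<le> (\<Sum>l\<le>s. (real n * p) ^ l * distinct_prob s l)"
proof -
  let ?N = "\<lambda>l. real (card (simple_paths {..<n} u v l))"
  have card_le: "real n * ?N l \<le> real n ^ l" for l
    using card_simple_paths_le[of "{..<n}" u v l] assms(1)
    by (simp flip: of_nat_mult of_nat_power)
  have "real n * measure_pmf.prob (colored_gnp_pmf n p s) {(E, col). rainbow_joined {..<n} E col u v}
      \<le> real n * (\<Sum>l<n. ?N l * (p ^ l * distinct_prob s l))"
    by (intro mult_left_mono prob_rainbow_joined_le_sum_paths p s) simp
  also have "\<dots> = (\<Sum>l<n. (real n * ?N l) * (p ^ l * distinct_prob s l))"
    by (simp add: sum_distrib_left mult.assoc)
  also have "\<dots> \<le> (\<Sum>l<n. real n ^ l * (p ^ l * distinct_prob s l))"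
    using p by (intro sum_mono mult_right_mono card_le) (simp add: distinct_prob_nonneg)
  also have "\<dots> = (\<Sum>l<n. (real n * p) ^ l * distinct_prob s l)"
    by (simp add: power_mult_distrib mult.assoc)
  also have "\<dots> \<le> (\<Sum>l\<le>max n s. (real n * p) ^ l * distinct_prob s l)"
    using p by (intro sum_mono2) (auto simp: distinct_prob_nonneg)
  also have "\<dots> = (\<Sum>l\<le>s. (real n * p) ^ l * distinct_prob s l)"
    by (rule sum.mono_neutral_right) (auto simp: distinct_prob_eq_0)
  finally show ?thesis .
qed

lemma power_mult_distinct_prob:
  assumes d: "d > 0" and "l \<le> s"
  shows "d ^ l * distinct_prob s l =
    fact s * (d / real s) ^ s * ((real s / d) ^ (s - l) / fact (s - l))"
proof (cases "s = 0")
  case False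
  have "d ^ l * distinct_prob s l = fact s * (d / real s) ^ l / fact (s - l)"
    using assms(2) binomial_fact[of l s, where ?'a = real]
    by (simp add: distinct_prob_def power_divide mult.commute)
  also have "(d / real s) ^ l = (d / real s) ^ s * (real s / d) ^ (s - l)"
    using assms False by (simp add: power_diff power_divide)
  finally show ?thesis
    by (simp add: mult.assoc)
qed (use assms in \<open>simp add: distinct_prob_def\<close>)

lemma sum_power_le_exp:
  fixes x :: real
  assumes "x \<ge> 0"
  shows "(\<Sum>j\<le>m. x ^ j / fact j) \<le> exp x"
  using sum_le_suminf[OF summable_exp_generic[of x], of "{..m}"] assms
  by (simp add: exp_def divide_inverse mult.commute)

lemma sum_power_mult_distinct_prob_le:
  assumes d: "d > 0"
  shows "(\<Sum>l\<le>s. d ^ l * distinct_prob s l) \<le> fact s * (d / real s) ^ s * exp (real s / d)"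
proof -
  have "(\<Sum>l\<le>s. d ^ l * distinct_prob s l) =
      fact s * (d / real s) ^ s * (\<Sum>l\<le>s. (real s / d) ^ (s - l) / fact (s - l))"
    using d by (simp add: power_mult_distinct_prob sum_distrib_left)
  also have "(\<Sum>l\<le>s. (real s / d) ^ (s - l) / fact (s - l)) = (\<Sum>j\<le>s. (real s / d) ^ j / fact j)"
    by (rule sum.reindex_bij_witness[of _ "\<lambda>j. s - j" "\<lambda>j. s - j"]) auto
  also have "fact s * (d / real s) ^ s * \<dots> \<le> fact s * (d / real s) ^ s * exp (real s / d)"
    using d by (intro mult_left_mono sum_power_le_exp) auto
  finally show ?thesis .
qed

lemma ln_fact_le:
  assumes "s \<ge> 1"
  shows "ln (fact s) \<le> 1 + ln (real s) / 2 + real s * (ln (real s) - 1)"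
  using assms
proof (induction s rule: dec_induct)
  case base
  show ?case by simp
next
  case (step m)
  have "1 \<le> (real m + 1 / 2) * (ln (real (Suc m)) - ln (real m))"
    using ln_inverse_approx_ge[of "real m" "real (Suc m)"] step.hyps by (simp add: field_simps)
  moreover have "ln (fact (Suc m)) = ln (real (Suc m)) + ln (fact m)"
    by (simp add: ln_mult)
  ultimately show ?case
    using step.IH by (simp add: algebra_simps)
qed

lemma fact_le_stirling:
  assumes "s \<ge> 1"
  shows "fact s \<le> exp 1 * sqrt (real s) * (real s / exp 1) ^ s"
proof -
  have "fact s \<le> exp (1 + ln (real s) / 2 + real s * (ln (real s) - 1))"
    using ln_fact_le[OF assms] by (metis exp_le_cancel_iff exp_ln fact_gt_zero)
  also have "\<dots> = exp 1 * exp (ln (sqrt (real s))) * exp (ln (real s) - 1) ^ s"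
    using assms by (simp add: exp_add exp_of_nat_mult ln_sqrt)
  finally show ?thesis
    using assms by (simp add: exp_diff)
qed

definition first_moment_bound :: "real \<Rightarrow> real \<Rightarrow> real" where
  "first_moment_bound d x = exp 1 * sqrt x * exp (x * (ln d - 1)) * exp (x / d)"

lemma first_moment_bound_mono:
  assumes "d \<ge> exp 1" "0 \<le> x" "x \<le> y"
  shows "first_moment_bound d x \<le> first_moment_bound d y"
proof -
  have "d > 0"
    using exp_gt_zero assms(1) by (rule less_le_trans)
  moreover from this have "ln d \<ge> 1"
    using assms(1) by (simp add: ln_ge_iff)
  ultimately show ?thesis
    unfolding first_moment_bound_def using assms
    by (intro mult_mono) (auto intro!: mult_right_mono divide_right_mono)
qed

lemma prob_rainbow_connected_le:
  assumes n: "n \<ge> 2" and d: "0 < d" "d \<le> real n" and s: "s \<ge> 1"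
  shows "measure_pmf.prob (colored_gnp_pmf n (d / real n) s)
      {(E, col). rainbow_connected {..<n} E col} \<le> first_moment_bound d (real s) / real n"
proof -
  let ?P = "measure_pmf.prob (colored_gnp_pmf n (d / real n) s)"
  have "real n * ?P {(E, col). rainbow_connected {..<n} E col}
      \<le> real n * ?P {(E, col). rainbow_joined {..<n} E col 0 1}"
    using n by (intro mult_left_mono measure_pmf.finite_measure_mono)
      (auto intro: rainbow_connected_imp_joined)
  also have "\<dots> \<le> (\<Sum>l\<le>s. d ^ l * distinct_prob s l)"
    using prob_rainbow_joined_le[of 0 1 "d / real n" s n] n d s by simp
  also have "\<dots> \<le> fact s * (d / real s) ^ s * exp (real s / d)"
    by (rule sum_power_mult_distinct_prob_le[OF d(1)])
  also have "\<dots> \<le> exp 1 * sqrt (real s) * (real s / exp 1) ^ s * (d / real s) ^ s * exp (real s / d)"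
    using d s by (intro mult_right_mono fact_le_stirling) auto
  also have "\<dots> = exp 1 * sqrt (real s) * (d / exp 1) ^ s * exp (real s / d)"
    using s by (simp add: power_divide)
  also have "(d / exp 1) ^ s = exp (real s * (ln d - 1))"
    using d by (simp add: exp_of_nat_mult exp_diff)
  finally show ?thesis
    using n by (simp add: first_moment_bound_def field_simps)
qed

text \<open>The largest number of colors allowed when \<open>p = c * t / n\<close>, with \<open>t = ln n\<close>.\<close>
definition color_threshold :: "real \<Rightarrow> real \<Rightarrow> real" where
  "color_threshold c t = t / (ln c - 1 + ln t) - 1 / 2 + ln (ln t) / (3 * ln t)"

lemma first_moment_bound_color_threshold_tendsto_0:
  assumes "c > 0"
  shows "((\<lambda>t. first_moment_bound (c * t) (color_threshold c t) / exp t) \<longlongrightarrow> 0) at_top"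
proof (rule Lim_transform_eventually)
  let ?k = "\<lambda>t. ln c - 1 + ln t" and ?\<epsilon> = "\<lambda>t. ln (ln t) / (3 * ln t)"
  let ?f = "\<lambda>t. exp 1 * sqrt (color_threshold c t) * exp (?k t * ?\<epsilon> t - ?k t / 2) *
      exp (color_threshold c t / (c * t))"
  show "(?f \<longlongrightarrow> 0) at_top"
    unfolding color_threshold_def using assms by real_asymp
  have "\<forall>\<^sub>F t in at_top. ?k t > 0" "\<forall>\<^sub>F t::real in at_top. t > 0"
    by real_asymp+
  then show "\<forall>\<^sub>F t in at_top.
      ?f t = first_moment_bound (c * t) (color_threshold c t) / exp t"
  proof eventually_elim
    case (elim t)
    \<comment> \<open>The main term \<open>t\<close> of the exponent cancels against the denominator \<open>exp t\<close>.\<close>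
    have "color_threshold c t * (ln (c * t) - 1) = t + (?k t * ?\<epsilon> t - ?k t / 2)"
      using elim assms by (simp add: color_threshold_def ln_mult field_simps)
    then show ?case
      by (simp add: first_moment_bound_def exp_add)
  qed
qed

lemma prob_rainbow_connected_tendsto_0:
  assumes c: "c > 0" and s: "\<And>n. s n \<ge> 1"
    and s_le: "\<forall>\<^sub>F n in sequentially. real (s n) \<le> color_threshold c (ln (real n))"
  shows "(\<lambda>n. measure_pmf.prob (colored_gnp_pmf n (c * ln (real n) / real n) (s n))
    {(E, col). rainbow_connected {..<n} E col}) \<longlonglongrightarrow> 0"
proof (rule tendsto_sandwich[OF _ _ tendsto_const])
  let ?b = "\<lambda>t. first_moment_bound (c * t) (color_threshold c t) / exp t"
  let ?P = "\<lambda>n. measure_pmf.prob (colored_gnp_pmf n (c * ln (real n) / real n) (s n))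
    {(E, col). rainbow_connected {..<n} E col}"
  have "\<forall>\<^sub>F n in sequentially. exp 1 \<le> c * ln (real n)"
    "\<forall>\<^sub>F n in sequentially. c * ln (real n) \<le> real n"
    using c by real_asymp+
  then show "\<forall>\<^sub>F n in sequentially. ?P n \<le> ?b (ln (real n))"
    using s_le eventually_ge_at_top[of 2]
  proof eventually_elim
    case (elim n)
    have "c * ln (real n) > 0"
      using elim(1) exp_gt_zero[of "1::real"] by linarith
    then have "?P n \<le> first_moment_bound (c * ln (real n)) (real (s n)) / real n"
      using elim s by (intro prob_rainbow_connected_le) auto
    also have "\<dots> \<le> first_moment_bound (c * ln (real n)) (color_threshold c (ln (real n))) / real n"
      using elim by (intro divide_right_mono first_moment_bound_mono) auto
    finally show ?case using elim by simp
  qed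
  have "filterlim (\<lambda>n. ln (real n)) at_top sequentially"
    by real_asymp
  then show "(\<lambda>n. ?b (ln (real n))) \<longlonglongrightarrow> 0"
    by (rule filterlim_compose[OF first_moment_bound_color_threshold_tendsto_0[OF c]])
qed simp

theorem theorem5p1:
  fixes c :: real and s :: "nat \<Rightarrow> nat"
  assumes "c > 1"
    and "\<And>n. s n \<ge> 1"
    and "\<forall>\<^sub>F n in sequentially.
           real (s n) \<le> ln (real n) / (ln c - 1 + ln (ln (real n))) - 1 / 2
             + ln (ln (ln (real n))) / (3 * ln (ln (real n)))"
  shows "(\<lambda>n. measure_pmf.prob (colored_gnp_pmf n (c * ln (real n) / real n) (s n))
           {(E, col). \<not> rainbow_connected {..<n} E col}) \<longlonglongrightarrow> 1"
proof -
  let ?M = "\<lambda>n. colored_gnp_pmf n (c * ln (real n) / real n) (s n)"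
  let ?connected = "\<lambda>n. {(E, col :: nat set \<Rightarrow> nat). rainbow_connected {..<n} E col}"
  have "(\<lambda>n. measure_pmf.prob (?M n) (?connected n)) \<longlonglongrightarrow> 0"
    using assms by (intro prob_rainbow_connected_tendsto_0) (auto simp: color_threshold_def)
  then have "(\<lambda>n. 1 - measure_pmf.prob (?M n) (?connected n)) \<longlonglongrightarrow> 1 - 0"
    by (intro tendsto_diff tendsto_const)
  moreover have not_connected:
    "{(E, col). \<not> rainbow_connected {..<n} E col} = space (?M n) - ?connected n" for n
    by auto
  ultimately show ?thesis
    by (simp only: not_connected measure_pmf.prob_compl sets_measure_pmf UNIV_I diff_zero)
qed

end
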